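(* With the definitions in the context, let $$L_R'=\frac{\pi\hat s_\theta^2}{\alpha}+K_1 .$$ Then for every real $p^2\neq0$ at which the exact amplitude $A_W^{\rm SM}(p^2)$ is finite, the resummed exact and effective charged-current amplitudes coincide at $L_R=L_R'$: $$A_W^{\rm EFF}(p^2,L_R')=A_W^{\rm SM}(p^2).$$
   Context: Let $\alpha,G_F>0$, $\hat s_\theta^2\in(0,1)$, and let $m_e,m_\mu,m_\tau,m_u,m_d,m_c,m_s,m_t,m_b>0$ be fermion masses (in fixed units). Put $$K_1=\tfrac12+\tfrac1{12}\ln(m_e^2m_\mu^2m_\tau^2)+\tfrac16\ln(m_u^2m_c^2m_t^2)+\tfrac1{12}\ln(m_d^2m_s^2m_b^2),\qquad \hat M^2=\frac{\pi\alpha}{\sqrt2\,G_F\hat s_\theta^2}.$$ $L_R=\ln\mu_R^2$ is a real variable ($\mu_R$ the renormalization scale), and $L=\ln(-p^2-i\epsilon)$, i.e. $L=\ln|p^2|$ if $p^2<0$ and $L=\ln p^2-i\pi$ if $p^2>0$. The one-fermion-loop $W$ self-energy function is $$\Sigma_W(p^2)=-\frac{p^2}{\pi^2}\Big(L_R-L+\tfrac53\Big)+\frac{3m_t^2}{8\pi^2}\Big(L_R-\ln m_t^2+\tfrac12\Big),\qquad \Sigma_W(0)=\frac{3m_t^2}{8\pi^2}\Big(L_R-\ln m_t^2+\tfrac12\Big).$$ The Lagrangian parameters are fixed from data as functions of $L_R$: $$F_1=1-\frac{\alpha}{\pi\hat s_\theta^2}(L_R-K_1),\qquad g^2=\frac{4\pi\alpha}{\hat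 s_\theta^2F_1},\qquad M^2=\frac{\hat M^2}{F_1}\big(1-\sqrt2\,G_F\,\Sigma_W(0)\big).$$ The amplitudes induced by charged currents of virtuality $p^2$, with one-fermion-loop corrections resummed to all orders, are, in the electroweak standard model and in the four-fermion Fermi model respectively, $$A_W^{\rm SM}(p^2)=\frac{i\Gamma}{8}\Big\{\frac{p^2}{g^2}-\frac{M^2}{g^2}-\frac{\Sigma_W(p^2)}4\Big\}^{-1},\qquad A_W^{\rm EFF}(p^2,L_R)=\frac{i\Gamma}{8}\Big\{-\frac{M^2}{g^2}-\frac{\Sigma_W(p^2)}4\Big\}^{-1},$$ where $\Gamma=\gamma_\alpha(1-\gamma_5)\otimes\gamma^\alpha(1-\gamma_5)$ is a fixed Dirac structure and $g^2,M^2$ are the functions $g^2=4\pi\alpha/(\hat s_\theta^2F_1)$ and $M^2=(\hat M^2/F_1)\big(1-\sqrt2\,G_F\,\Sigma_W(0)\big)$ of $L_R$. The quantity $A_W^{\rm SM}(p^2)$ is independent of $L_R$. Both amplitudes depend on $g^2,M^2$ only through $1/g^2$ and $M^2/g^2$, which are polynomials in $L_R$. At $L_R=L_R'$, where $F_1=0$, they are evaluated through these polynomials. *)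

theory Defs
  imports "HOL-Analysis.Analysis" "HOL-Computational_Algebra.Polynomial"
begin

record ew_params =
  alpha :: real
  G_F :: real
  s2 :: real
  m_e :: real
  m_mu :: real
  m_tau :: real
  m_u :: real
  m_d :: real
  m_c :: real
  m_s :: real
  m_t :: real
  m_b :: real

definition admissible :: "ew_params \<Rightarrow> bool" where
  "admissible P \<longleftrightarrow>
     0 < alpha P \<and> 0 < G_F P \<and> 0 < s2 P \<and> s2 P < 1 \<and>
     0 < m_e P \<and> 0 < m_mu P \<and> 0 < m_tau P \<and>
     0 < m_u P \<and> 0 < m_d P \<and> 0 < m_c P \<and> 0 < m_s P \<and> 0 < m_t P \<and> 0 < m_b P"

definition K1 :: "ew_params \<Rightarrow> real" where
  "K1 P = 1/2 + 1/12 * ln ((m_e P)\<^sup>2 * (m_mu P)\<^sup>2 * (m_tau P)\<^sup>2)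
        + 1/6 * ln ((m_u P)\<^sup>2 * (m_c P)\<^sup>2 * (m_t P)\<^sup>2)
        + 1/12 * ln ((m_d P)\<^sup>2 * (m_s P)\<^sup>2 * (m_b P)\<^sup>2)"

definition M2hat :: "ew_params \<Rightarrow> real" where
  "M2hat P = pi * alpha P / (sqrt 2 * G_F P * s2 P)"

text \<open>The logarithm \<open>L = ln (-p\<^sup>2 - i \<epsilon>)\<close> as a function of the real number \<open>p\<^sup>2\<close>; on the
  cut it lies on the opposite side from the library's principal branch \<^const>\<open>Ln\<close>
  (see \<open>log_L_limit\<close>).\<close>

definition log_L :: "real \<Rightarrow> complex" where
  "log_L p2 = (if p2 < 0 then of_real (ln \<bar>p2\<bar>) else of_real (ln p2) - \<i> * of_real pi)"

lemma log_L_limit: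
  assumes "p2 \<noteq> 0"
  shows "((\<lambda>\<epsilon>. Ln (- of_real p2 - \<i> * of_real \<epsilon>)) \<longlongrightarrow> log_L p2) (at_right 0)"
proof (cases "p2 < 0")
  case True
  have "((\<lambda>\<epsilon>::real. - of_real p2 - \<i> * of_real \<epsilon>) \<longlongrightarrow> - of_real p2 - \<i> * of_real 0) (at_right 0)"
    by (intro tendsto_intros)
  then have "((\<lambda>\<epsilon>::real. Ln (- of_real p2 - \<i> * of_real \<epsilon>)) \<longlongrightarrow> Ln (of_real (- p2))) (at_right 0)"
    using True by (intro tendsto_Ln) (auto simp: complex_nonpos_Reals_iff)
  moreover have "Ln (of_real (- p2)) = of_real (ln \<bar>p2\<bar>)"
    using True by (subst Ln_of_real) auto
  ultimately show ?thesis
    using True by (simp add: log_L_def)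
next
  case False
  with assms have p: "p2 > 0" by simp
  have eq: "Ln (- of_real p2 - \<i> * of_real \<epsilon>) = Ln (of_real p2 + \<i> * of_real \<epsilon>) - \<i> * of_real pi"
    if "\<epsilon> > 0" for \<epsilon> :: real
  proof -
    have "of_real p2 + \<i> * of_real \<epsilon> \<noteq> (0::complex)"
      using p by (simp add: complex_eq_iff)
    then have "Ln (- (of_real p2 + \<i> * of_real \<epsilon>)) = Ln (of_real p2 + \<i> * of_real \<epsilon>) - \<i> * of_real pi"
      using that p by (subst Ln_minus) auto
    then show ?thesis by simp
  qed
  have "((\<lambda>\<epsilon>::real. of_real p2 + \<i> * of_real \<epsilon>) \<longlongrightarrow> of_real p2 + \<i> * of_real 0) (at_right 0)"
    by (intro tendsto_intros)
  then have "((\<lambda>\<epsilon>::real. Ln (of_real p2 + \<i> * of_real \<epsilon>)) \<longlongrightarrow> Ln (of_real p2)) (at_right 0)"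
    using p by (intro tendsto_Ln) (auto simp: complex_nonpos_Reals_iff)
  then have "((\<lambda>\<epsilon>::real. Ln (of_real p2 + \<i> * of_real \<epsilon>) - \<i> * of_real pi) \<longlongrightarrow> log_L p2) (at_right 0)"
    using p False by (auto simp: log_L_def Ln_of_real intro!: tendsto_intros)
  moreover have "\<forall>\<^sub>F \<epsilon> in at_right (0::real).
      Ln (of_real p2 + \<i> * of_real \<epsilon>) - \<i> * of_real pi = Ln (- of_real p2 - \<i> * of_real \<epsilon>)"
    using eq by (auto simp: eventually_at_right_less eventually_at_filter)
  ultimately show ?thesis
    by (rule Lim_transform_eventually)
qed

definition Sigma_W :: "ew_params \<Rightarrow> real \<Rightarrow> real \<Rightarrow> complex" where
  "Sigma_W P LR p2 =
     - of_real (p2 / pi\<^sup>2) * (of_real LR - log_L p2 + 5/3)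
     + of_real (3 * (m_t P)\<^sup>2 / (8 * pi\<^sup>2) * (LR - ln ((m_t P)\<^sup>2) + 1/2))"

definition Sigma_W0 :: "ew_params \<Rightarrow> real \<Rightarrow> real" where
  "Sigma_W0 P LR = 3 * (m_t P)\<^sup>2 / (8 * pi\<^sup>2) * (LR - ln ((m_t P)\<^sup>2) + 1/2)"

lemma Sigma_W_0: "Sigma_W P LR 0 = of_real (Sigma_W0 P LR)"
  by (simp add: Sigma_W_def Sigma_W0_def)

definition F1 :: "ew_params \<Rightarrow> real \<Rightarrow> real" where
  "F1 P LR = 1 - alpha P / (pi * s2 P) * (LR - K1 P)"

definition g2 :: "ew_params \<Rightarrow> real \<Rightarrow> real" where
  "g2 P LR = 4 * pi * alpha P / (s2 P * F1 P LR)"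

definition M2 :: "ew_params \<Rightarrow> real \<Rightarrow> real" where
  "M2 P LR = M2hat P / F1 P LR * (1 - sqrt 2 * G_F P * Sigma_W0 P LR)"

text \<open>Where \<open>F1\<close> vanishes, \<^const>\<open>g2\<close> and \<^const>\<open>M2\<close> are infinite on paper but \<open>0\<close> in HOL.
  The amplitudes therefore use the polynomials in \<open>LR\<close> that agree with \<open>1 / g2\<close> and
  \<open>M2 / g2\<close> wherever \<open>F1\<close> is nonzero; both exist and are unique for admissible parameters.\<close>

definition inv_g2_poly :: "ew_params \<Rightarrow> real poly" where
  "inv_g2_poly P = (THE q. \<forall>LR. F1 P LR \<noteq> 0 \<longrightarrow> poly q LR = 1 / g2 P LR)"

definition M2_over_g2_poly :: "ew_params \<Rightarrow> real poly" where
  "M2_over_g2_poly P = (THE q. \<forall>LR. F1 P LR \<noteq> 0 \<longrightarrow> poly q LR = M2 P LR / g2 P LR)"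

lemma poly_eq_if_agree_off_F1_zero:
  assumes "admissible P"
    and "\<forall>LR. F1 P LR \<noteq> 0 \<longrightarrow> poly q LR = f LR"
    and "\<forall>LR. F1 P LR \<noteq> 0 \<longrightarrow> poly r LR = f LR"
  shows "q = r"
proof (rule ccontr)
  assume "q \<noteq> r"
  then have "finite {x. poly (q - r) x = 0}"
    by (intro poly_roots_finite) simp
  moreover have "{x. F1 P x \<noteq> 0} \<subseteq> {x. poly (q - r) x = 0}"
    using assms by auto
  ultimately have "finite {x. F1 P x \<noteq> 0}"
    using finite_subset by blast
  moreover have "{x. F1 P x = 0} \<subseteq> {pi * s2 P / alpha P + K1 P}"
    using assms(1) by (auto simp: F1_def admissible_def field_simps)
  then have "finite {x. F1 P x = 0}"
    using finite_subset by blast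
  ultimately have "finite ({x. F1 P x \<noteq> 0} \<union> {x. F1 P x = 0})"
    by simp
  moreover have "{x. F1 P x \<noteq> 0} \<union> {x. F1 P x = 0} = (UNIV :: real set)"
    by auto
  ultimately show False
    using infinite_UNIV_char_0[where ?'a = real] by simp
qed

lemma inv_g2_poly_unique_existence:
  assumes "admissible P"
  shows "\<exists>!q. \<forall>LR. F1 P LR \<noteq> 0 \<longrightarrow> poly q LR = 1 / g2 P LR"
proof (rule ex_ex1I)
  define c where "c = alpha P / (pi * s2 P)"
  define k where "k = s2 P / (4 * pi * alpha P)"
  define q where "q = smult k [:1 + c * K1 P, - c:]"
  have F: "F1 P LR = 1 - c * (LR - K1 P)" for LR
    by (simp add: F1_def c_def)
  have "poly q LR = k * F1 P LR" for LR
    unfolding F q_def by (simp add: algebra_simps)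
  then have "poly q LR = 1 / g2 P LR" for LR
    by (simp add: g2_def k_def)
  then show "\<exists>q. \<forall>LR. F1 P LR \<noteq> 0 \<longrightarrow> poly q LR = 1 / g2 P LR"
    by blast
qed (rule poly_eq_if_agree_off_F1_zero[OF assms])

lemma M2_over_g2_poly_unique_existence:
  assumes "admissible P"
  shows "\<exists>!q. \<forall>LR. F1 P LR \<noteq> 0 \<longrightarrow> poly q LR = M2 P LR / g2 P LR"
proof (rule ex_ex1I)
  define c where "c = 3 * (m_t P)\<^sup>2 / (8 * pi\<^sup>2)"
  define q where "q = smult (M2hat P * s2 P / (4 * pi * alpha P))
    [:1 - sqrt 2 * G_F P * c * (1/2 - ln ((m_t P)\<^sup>2)), - (sqrt 2 * G_F P * c):]"
  have S: "Sigma_W0 P LR = c * (LR - ln ((m_t P)\<^sup>2) + 1/2)" for LR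
    by (simp add: Sigma_W0_def c_def)
  have "poly q LR = M2 P LR / g2 P LR" if "F1 P LR \<noteq> 0" for LR
  proof -
    have "M2 P LR / g2 P LR
        = M2hat P * s2 P / (4 * pi * alpha P) * (1 - sqrt 2 * G_F P * Sigma_W0 P LR)"
      using that by (simp add: M2_def g2_def)
    also have "\<dots> = poly q LR"
      unfolding S q_def by (simp add: algebra_simps)
    finally show ?thesis by simp
  qed
  then show "\<exists>q. \<forall>LR. F1 P LR \<noteq> 0 \<longrightarrow> poly q LR = M2 P LR / g2 P LR"
    by blast
qed (rule poly_eq_if_agree_off_F1_zero[OF assms])

definition inv_g2 :: "ew_params \<Rightarrow> real \<Rightarrow> real" where
  "inv_g2 P LR = poly (inv_g2_poly P) LR"

definition M2_over_g2 :: "ew_params \<Rightarrow> real \<Rightarrow> real" where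
  "M2_over_g2 P LR = poly (M2_over_g2_poly P) LR"

text \<open>Dirac matrices \<open>\<gamma>\<^sup>0, \<dots>, \<gamma>\<^sup>3\<close> in an arbitrary four-dimensional representation, metric
  signature \<open>(+,-,-,-)\<close>.\<close>

definition mink :: "nat \<Rightarrow> nat \<Rightarrow> complex" where
  "mink a b = (if a \<noteq> b then 0 else if a = 0 then 1 else -1)"

definition dirac_matrices :: "(nat \<Rightarrow> complex^4^4) \<Rightarrow> bool" where
  "dirac_matrices gam \<longleftrightarrow>
     (\<forall>a<4. \<forall>b<4. gam a ** gam b + gam b ** gam a = mat (2 * mink a b))"

definition gamma5 :: "(nat \<Rightarrow> complex^4^4) \<Rightarrow> complex^4^4" where
  "gamma5 gam = mat \<i> ** gam 0 ** gam 1 ** gam 2 ** gam 3"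

definition kron :: "complex^4^4 \<Rightarrow> complex^4^4 \<Rightarrow> complex^(4 \<times> 4)^(4 \<times> 4)" where
  "kron A B = (\<chi> i j. A $ fst i $ fst j * B $ snd i $ snd j)"

definition Gamma_VA :: "(nat \<Rightarrow> complex^4^4) \<Rightarrow> complex^(4 \<times> 4)^(4 \<times> 4)" where
  "Gamma_VA gam =
     (\<Sum>a<4. kron ((\<Sum>b<4. mat (mink a b) ** gam b) ** (mat 1 - gamma5 gam))
                  (gam a ** (mat 1 - gamma5 gam)))"

definition SM_denom :: "ew_params \<Rightarrow> real \<Rightarrow> real \<Rightarrow> complex" where
  "SM_denom P LR p2 =
     of_real (p2 * inv_g2 P LR) - of_real (M2_over_g2 P LR) - Sigma_W P LR p2 / 4"

definition EFF_denom :: "ew_params \<Rightarrow> real \<Rightarrow> real \<Rightarrow> complex" where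
  "EFF_denom P LR p2 = - of_real (M2_over_g2 P LR) - Sigma_W P LR p2 / 4"

text \<open>The amplitudes are \<open>(\<i> / 8) D\<^sup>-\<^sup>1 \<Gamma>\<close>. As \<open>\<Gamma> \<noteq> 0\<close>, such an amplitude is finite
  exactly when its denominator \<open>D\<close> is nonzero (in HOL, \<open>inverse 0 = 0\<close>).\<close>

definition A_SM :: "(nat \<Rightarrow> complex^4^4) \<Rightarrow> ew_params \<Rightarrow> real \<Rightarrow> real \<Rightarrow> complex^(4 \<times> 4)^(4 \<times> 4)" where
  "A_SM gam P LR p2 = mat (\<i> / 8 * inverse (SM_denom P LR p2)) ** Gamma_VA gam"

definition A_EFF :: "(nat \<Rightarrow> complex^4^4) \<Rightarrow> ew_params \<Rightarrow> real \<Rightarrow> real \<Rightarrow> complex^(4 \<times> 4)^(4 \<times> 4)" where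
  "A_EFF gam P LR p2 = mat (\<i> / 8 * inverse (EFF_denom P LR p2)) ** Gamma_VA gam"

definition LR_match :: "ew_params \<Rightarrow> real" where
  "LR_match P = pi * s2 P / alpha P + K1 P"

end

(* Multiplied by 1/g^2, the counterterm in M^2 cancels Sigma_W(0) identically, so both denominators
   depend on L_R only through the vacuum-polarization term p^2 L_R / (4 pi^2); in the exact amplitude
   the running of p^2/g^2 cancels this as well.  At L_R = L_R' one has F_1 = 0, hence 1/g^2 = 0, and
   the two denominators agree there. *)
theory Submission
  imports Defs
begin

text \<open>The linear polynomial on the right agrees with \<open>1 / g2\<close> off the zero of
  \<open>F1\<close>, so by uniqueness it is the one that \<open>THE\<close> selects. The formula
  therefore holds also where \<open>F1\<close> vanishes.\<close>

lemma inv_g2_eq: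
  assumes "admissible P"
  shows "inv_g2 P LR = s2 P / (4 * pi * alpha P) * F1 P LR"
proof -
  define c where "c = alpha P / (pi * s2 P)"
  define k where "k = s2 P / (4 * pi * alpha P)"
  define q where "q = smult k [:1 + c * K1 P, - c:]"
  have q: "poly q x = k * F1 P x" for x
    by (simp add: q_def F1_def flip: c_def) (simp add: algebra_simps)
  then have "\<forall>x. F1 P x \<noteq> 0 \<longrightarrow> poly q x = 1 / g2 P x"
    by (simp add: g2_def k_def)
  then have "inv_g2_poly P = q"
    unfolding inv_g2_poly_def
    by (rule the1_equality[OF inv_g2_poly_unique_existence[OF assms]])
  then show ?thesis
    by (simp add: inv_g2_def q k_def)
qed

text \<open>The factors \<open>F1\<close> cancel in the quotient, and
  \<open>M2hat P * s2 P / (4 * pi * alpha P)\<close> reduces to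
  \<open>1 / (4 * sqrt 2 * G_F P)\<close>.\<close>

lemma M2_over_g2_eq:
  assumes "admissible P"
  shows "M2_over_g2 P LR = (1 / (sqrt 2 * G_F P) - Sigma_W0 P LR) / 4"
proof -
  define c where "c = 3 * (m_t P)\<^sup>2 / (8 * pi\<^sup>2)"
  define q where "q = smult (1/4)
    [:1 / (sqrt 2 * G_F P) - c * (1/2 - ln ((m_t P)\<^sup>2)), - c:]"
  have q: "poly q x = (1 / (sqrt 2 * G_F P) - Sigma_W0 P x) / 4" for x
    unfolding q_def Sigma_W0_def c_def[symmetric]
    by (simp add: algebra_simps add_divide_distrib diff_divide_distrib)
  have pos: "alpha P \<noteq> 0" "G_F P \<noteq> 0" "s2 P \<noteq> 0"
    using assms by (auto simp: admissible_def)
  have "poly q x = M2 P x / g2 P x" if "F1 P x \<noteq> 0" for x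
    unfolding q M2_def g2_def M2hat_def using that pos by (simp add: field_simps)
  then have "\<forall>x. F1 P x \<noteq> 0 \<longrightarrow> poly q x = M2 P x / g2 P x"
    by blast
  then have "M2_over_g2_poly P = q"
    unfolding M2_over_g2_poly_def
    by (rule the1_equality[OF M2_over_g2_poly_unique_existence[OF assms]])
  then show ?thesis
    by (simp add: M2_over_g2_def q)
qed

lemma inv_g2_LR_match:
  assumes "admissible P"
  shows "inv_g2 P (LR_match P) = 0"
  using assms by (simp add: inv_g2_eq F1_def LR_match_def admissible_def)

text \<open>The couplings cancel in the slope of \<open>inv_g2\<close>, which leaves a pure number
  that can match the slope of \<open>Sigma_W\<close>.\<close>

lemma inv_g2_diff:
  assumes "admissible P"
  shows "inv_g2 P LR - inv_g2 P LR' = (LR' - LR) / (4 * pi\<^sup>2)"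
proof -
  have "alpha P \<noteq> 0" "s2 P \<noteq> 0"
    using assms by (auto simp: admissible_def)
  then show ?thesis
    by (simp add: inv_g2_eq[OF assms] F1_def field_simps power2_eq_square)
qed

lemma EFF_denom_eq:
  assumes "admissible P"
  shows "EFF_denom P LR p2 =
    of_real (p2 / (4 * pi\<^sup>2)) * (of_real LR - log_L p2 + 5/3) - of_real (1 / (4 * sqrt 2 * G_F P))"
  \<comment> \<open>Folding \<open>Sigma_W0\<close> exposes the top-mass term of
    \<open>Sigma_W\<close> as a single quantity that cancels as a whole.\<close>
  unfolding EFF_denom_def M2_over_g2_eq[OF assms] Sigma_W_def Sigma_W0_def[symmetric]
  by (simp add: algebra_simps add_divide_distrib diff_divide_distrib)

lemma SM_denom_eq_EFF_denom:
  "SM_denom P LR p2 = of_real (p2 * inv_g2 P LR) + EFF_denom P LR p2"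
  by (simp add: SM_denom_def EFF_denom_def)

lemma SM_denom_scale_independent:
  assumes "admissible P"
  shows "SM_denom P LR p2 = SM_denom P LR' p2"
proof -
  \<comment> \<open>The complex term \<open>log_L p2\<close> is the same at both scales and drops
    out, so the difference is real.\<close>
  have "SM_denom P LR p2 - SM_denom P LR' p2 =
      of_real (p2 * (inv_g2 P LR - inv_g2 P LR') + p2 / (4 * pi\<^sup>2) * (LR - LR'))"
    by (simp add: SM_denom_eq_EFF_denom EFF_denom_eq[OF assms] algebra_simps
        add_divide_distrib diff_divide_distrib)
  also have "\<dots> = 0"
    by (simp add: inv_g2_diff[OF assms] field_simps)
  finally show ?thesis
    by simp
qed

lemma EFF_denom_LR_match:
  assumes "admissible P"
  shows "EFF_denom P (LR_match P) p2 = SM_denom P LR p2"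
proof -
  have "EFF_denom P (LR_match P) p2 = SM_denom P (LR_match P) p2"
    by (simp add: SM_denom_eq_EFF_denom inv_g2_LR_match[OF assms])
  also have "\<dots> = SM_denom P LR p2"
    by (rule SM_denom_scale_independent[OF assms])
  finally show ?thesis .
qed

theorem mainTheorem2:
  fixes P :: ew_params and gam :: "nat \<Rightarrow> complex^4^4" and LR p2 :: real
  assumes "admissible P"
    and "dirac_matrices gam"
    and "p2 \<noteq> 0"
    and "SM_denom P LR p2 \<noteq> 0"
  shows "EFF_denom P (LR_match P) p2 \<noteq> 0 \<and>
         A_EFF gam P (LR_match P) p2 = A_SM gam P LR p2"
  using assms(4) by (simp add: A_EFF_def A_SM_def EFF_denom_LR_match[OF assms(1), of p2 LR])

end
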